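(* Let $M$ be a manifold-with-boundary equipped with a free circle action on a neighbourhood $U_M$ of its boundary, and let $M_{\mathrm{cut}}$ be its cut space. For an invariant boundary defining function $f \colon M\to\mathbb{R}_{\ge 0}$, let $\mathcal{F}_M$ be the set of functions $M_{\mathrm{cut}}\to\mathbb{R}$ constructed from $f$ as in the context. Then $\mathcal{F}_M$ is independent of the choice of the invariant boundary defining function $f$; that is, any two invariant boundary defining functions on $M$ yield the same set of functions.
   Context: Manifolds, with or without boundary, are smooth, Hausdorff and second countable. $S^1=\{a\in\mathbb{C}: |a|=1\}$. For a manifold-with-boundary $M$, $\mathring{M}$ denotes the interior and $\partial M$ the boundary. "A free circle action on a neighbourhood $U_M$ of the boundary" means a smooth free action of $S^1$ on an open neighbourhood $U_M$ of $\partial M$ in $M$; necessarily $\partial M$ is $S^1$-invariant. Cut space: let $\sim$ be the equivalence relation on $M$ in which distinct points are equivalent iff they both lie in $\partial M$ and lie in the same $S^1$-orbit. $M_{\mathrm{cut}} := M/{\sim}$; $c \colon M \to M_{\mathrm{cut}}$ is the quotient map. An invariant boundary defining function on $M$ is a smooth $f \colon M \to \mathbb{R}_{\ge 0}$ such that $f^{-1}(0)=\partial M$, $df|_{\partial M}$ never vanishes, and $f$ is $S^1$-invariant on some $S^1$-invariant neighbourhood of $\partial M$ in $U_M$. Given $f$, $\mathcal{F}_M$ is the set of functions $h \colon M_{\mathrm{cut}}\to\mathbb{R}$ such that $\widehat{h} := h\circ c$ satisfies: ($\mathcal{F}1$) $\widehat{h}|_{\mathring{M}} \colon \mathring{M}\to\mathbb{R}$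 is smooth; ($\mathcal{F}2$) there exist an $S^1$-invariant open neighbourhood $V$ of $\partial M$ in $U_M$ and a smooth function $H \colon V\times\mathbb{C}\to\mathbb{R}$ such that (a) $H(a\cdot x,z)=H(x,az)$ for all $a\in S^1$, $(x,z)\in V\times\mathbb{C}$, and (b) $\widehat{h}(x)=H(x,\sqrt{f(x)})$ for all $x\in V$. *)

theory Defs
  imports "HOL-Analysis.Analysis"
begin

section \<open>Smooth functions on subsets of Euclidean spaces\<close>

primrec Ck_open :: "nat \<Rightarrow> 'a::euclidean_space set \<Rightarrow> ('a \<Rightarrow> 'b::euclidean_space) \<Rightarrow> bool" where
  "Ck_open 0 S f \<longleftrightarrow> continuous_on S f"
| "Ck_open (Suc k) S f \<longleftrightarrow>
     (\<forall>x\<in>S. f differentiable (at x)) \<and> (\<forall>v. Ck_open k S (\<lambda>x. frechet_derivative f (at x) v))"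

text \<open>On an arbitrary subset, smooth means: locally the restriction of a smooth function on an
  open subset of the ambient space. For open subsets this is the usual notion; for relatively open
  subsets of a half-space it is smoothness up to the boundary; and for a product of the unit circle
  with such a set it is smoothness on the product manifold.\<close>

definition smooth_on :: "'a::euclidean_space set \<Rightarrow> ('a \<Rightarrow> 'b::euclidean_space) \<Rightarrow> bool" where
  "smooth_on S f \<longleftrightarrow>
     (\<forall>x\<in>S. \<exists>W g. open W \<and> x \<in> W \<and> (\<forall>k. Ck_open k W g) \<and> (\<forall>y\<in>S \<inter> W. g y = f y))"


section \<open>Manifolds with boundary\<close>

text \<open>The model is the half-space of vectors \<open>y\<close> in a linear subspace \<open>model_space\<close> of the
  Euclidean space \<open>'e\<close> with \<open>0 \<le> inward \<bullet> y\<close>. The dimension of the manifold is the dimension of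
  \<open>model_space\<close>, so that dimension zero, which no Euclidean space type has, is included.
  For \<open>inward = 0\<close> the model is all of \<open>model_space\<close> and has no boundary; for \<open>inward \<noteq> 0\<close>
  it is a closed half-space with the usual boundary hyperplane. A chart is a pair of its domain and
  its coordinate map; only the values of the map on the domain matter.\<close>

record ('a, 'e) bd_manifold =
  space_of :: "'a topology"
  model_space :: "'e set"
  inward :: 'e
  charts :: "('a set \<times> ('a \<Rightarrow> 'e)) set"

definition half_space :: "('a, 'e::euclidean_space) bd_manifold \<Rightarrow> 'e set" where
  "half_space M = {y \<in> model_space M. 0 \<le> inward M \<bullet> y}"

definition half_space_boundary :: "('a, 'e::euclidean_space) bd_manifold \<Rightarrow> 'e set" where
  "half_space_boundary M = {y \<in> model_space M. inward M \<noteq> 0 \<and> inward M \<bullet> y = 0}"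

definition manifold_with_boundary :: "('a, 'e::euclidean_space) bd_manifold \<Rightarrow> bool" where
  "manifold_with_boundary M \<longleftrightarrow>
     subspace (model_space M) \<and> inward M \<in> model_space M \<and>
     Hausdorff_space (space_of M) \<and> second_countable (space_of M) \<and>
     (\<Union>(W, \<phi>)\<in>charts M. W) = topspace (space_of M) \<and>
     (\<forall>(W, \<phi>)\<in>charts M.
        openin (space_of M) W \<and> openin (top_of_set (half_space M)) (\<phi> ` W) \<and>
        homeomorphic_map (subtopology (space_of M) W) (top_of_set (\<phi> ` W)) \<phi>) \<and>
     (\<forall>(W, \<phi>)\<in>charts M. \<forall>(W', \<phi>')\<in>charts M.
        smooth_on (\<phi> ` (W \<inter> W')) (\<lambda>y. \<phi>' (inv_into W \<phi> y)))"

definition mfd_boundary :: "('a, 'e::euclidean_space) bd_manifold \<Rightarrow> 'a set" where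
  "mfd_boundary M = {x. \<exists>(W, \<phi>)\<in>charts M. x \<in> W \<and> \<phi> x \<in> half_space_boundary M}"

definition mfd_interior :: "('a, 'e::euclidean_space) bd_manifold \<Rightarrow> 'a set" where
  "mfd_interior M = topspace (space_of M) - mfd_boundary M"

text \<open>Smoothness of real functions on an open subset \<open>V\<close> of \<open>M\<close>, and on \<open>V \<times> \<complex>\<close>.\<close>

definition smooth_fun ::
    "('a, 'e::euclidean_space) bd_manifold \<Rightarrow> 'a set \<Rightarrow> ('a \<Rightarrow> real) \<Rightarrow> bool" where
  "smooth_fun M V f \<longleftrightarrow>
     (\<forall>(W, \<phi>)\<in>charts M. smooth_on (\<phi> ` (W \<inter> V)) (\<lambda>y. f (inv_into W \<phi> y)))"

definition smooth_fun_times_complex ::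
    "('a, 'e::euclidean_space) bd_manifold \<Rightarrow> 'a set \<Rightarrow> ('a \<times> complex \<Rightarrow> real) \<Rightarrow> bool" where
  "smooth_fun_times_complex M V H \<longleftrightarrow>
     (\<forall>(W, \<phi>)\<in>charts M.
        smooth_on (\<phi> ` (W \<inter> V) \<times> UNIV) (\<lambda>(y, z). H (inv_into W \<phi> y, z)))"

text \<open>The differential at \<open>x\<close> is expressed in a chart by the derivative \<open>D\<close> within the image of the
  chart; the restriction of \<open>D\<close> to \<open>model_space\<close>, which represents the tangent space at \<open>x\<close>
  (also at boundary points), is uniquely determined.\<close>

definition nonzero_differential_at ::
    "('a, 'e::euclidean_space) bd_manifold \<Rightarrow> ('a \<Rightarrow> real) \<Rightarrow> 'a \<Rightarrow> bool" where
  "nonzero_differential_at M f x \<longleftrightarrow>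
     (\<forall>(W, \<phi>)\<in>charts M. x \<in> W \<longrightarrow>
        (\<exists>D. ((\<lambda>y. f (inv_into W \<phi> y)) has_derivative D) (at (\<phi> x) within \<phi> ` W) \<and>
             (\<exists>v\<in>model_space M. D v \<noteq> 0)))"


section \<open>Free circle actions near the boundary\<close>

abbreviation circle :: "complex set" where
  "circle \<equiv> sphere 0 1"

definition free_circle_action_near_boundary ::
    "('a, 'e::euclidean_space) bd_manifold \<Rightarrow> 'a set \<Rightarrow> (complex \<Rightarrow> 'a \<Rightarrow> 'a) \<Rightarrow> bool" where
  "free_circle_action_near_boundary M U act \<longleftrightarrow>
     openin (space_of M) U \<and> mfd_boundary M \<subseteq> U \<and>
     (\<forall>a\<in>circle. \<forall>x\<in>U. act a x \<in> U) \<and>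
     (\<forall>x\<in>U. act 1 x = x) \<and>
     (\<forall>a\<in>circle. \<forall>b\<in>circle. \<forall>x\<in>U. act (a * b) x = act a (act b x)) \<and>
     (\<forall>a\<in>circle. \<forall>x\<in>U. act a x = x \<longrightarrow> a = 1) \<and>
     continuous_map (prod_topology (top_of_set circle) (subtopology (space_of M) U))
       (subtopology (space_of M) U) (\<lambda>(a, x). act a x) \<and>
     (\<forall>(W, \<phi>)\<in>charts M. \<forall>(W', \<phi>')\<in>charts M.
        smooth_on {(a, y). a \<in> circle \<and> y \<in> \<phi> ` (W \<inter> U) \<and> act a (inv_into W \<phi> y) \<in> W'}
          (\<lambda>(a, y). \<phi>' (act a (inv_into W \<phi> y))))"

definition circle_invariant :: "(complex \<Rightarrow> 'a \<Rightarrow> 'a) \<Rightarrow> 'a set \<Rightarrow> bool" where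
  "circle_invariant act V \<longleftrightarrow> (\<forall>a\<in>circle. \<forall>x\<in>V. act a x \<in> V)"

text \<open>The neighbourhood \<open>N\<close> of the boundary need not be open.\<close>

definition invariant_boundary_defining ::
    "('a, 'e::euclidean_space) bd_manifold \<Rightarrow> 'a set \<Rightarrow> (complex \<Rightarrow> 'a \<Rightarrow> 'a) \<Rightarrow> ('a \<Rightarrow> real) \<Rightarrow> bool"
  where
  "invariant_boundary_defining M U act f \<longleftrightarrow>
     (\<forall>x\<in>topspace (space_of M). 0 \<le> f x) \<and>
     smooth_fun M (topspace (space_of M)) f \<and>
     {x \<in> topspace (space_of M). f x = 0} = mfd_boundary M \<and>
     (\<forall>x\<in>mfd_boundary M. nonzero_differential_at M f x) \<and>
     (\<exists>N G. openin (space_of M) G \<and> mfd_boundary M \<subseteq> G \<and> G \<subseteq> N \<and> N \<subseteq> U \<and>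
        circle_invariant act N \<and> (\<forall>a\<in>circle. \<forall>x\<in>N. f (act a x) = f x))"


section \<open>The cut space and its distinguished functions\<close>

definition cut_rel ::
    "('a, 'e::euclidean_space) bd_manifold \<Rightarrow> (complex \<Rightarrow> 'a \<Rightarrow> 'a) \<Rightarrow> ('a \<times> 'a) set" where
  "cut_rel M act =
     {(x, y). x \<in> topspace (space_of M) \<and> y \<in> topspace (space_of M) \<and>
        (x = y \<or> x \<in> mfd_boundary M \<and> y \<in> mfd_boundary M \<and> (\<exists>a\<in>circle. y = act a x))}"

text \<open>Only the underlying set of the cut space enters below; its topology is not needed.\<close>

definition cut_space ::
    "('a, 'e::euclidean_space) bd_manifold \<Rightarrow> (complex \<Rightarrow> 'a \<Rightarrow> 'a) \<Rightarrow> 'a set set" where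
  "cut_space M act = topspace (space_of M) // cut_rel M act"

definition cut_map ::
    "('a, 'e::euclidean_space) bd_manifold \<Rightarrow> (complex \<Rightarrow> 'a \<Rightarrow> 'a) \<Rightarrow> 'a \<Rightarrow> 'a set" where
  "cut_map M act x = cut_rel M act `` {x}"

text \<open>Functions on the cut space are represented by their extensional extensions, so that equality
  of sets of functions refers to the values on the cut space only.\<close>

definition cut_functions ::
    "('a, 'e::euclidean_space) bd_manifold \<Rightarrow> 'a set \<Rightarrow> (complex \<Rightarrow> 'a \<Rightarrow> 'a) \<Rightarrow> ('a \<Rightarrow> real) \<Rightarrow>
      ('a set \<Rightarrow> real) set" where
  "cut_functions M U act f =
     {h \<in> extensional (cut_space M act).
        smooth_fun M (mfd_interior M) (h \<circ> cut_map M act) \<and>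
        (\<exists>V H. openin (space_of M) V \<and> mfd_boundary M \<subseteq> V \<and> V \<subseteq> U \<and> circle_invariant act V \<and>
           smooth_fun_times_complex M V H \<and>
           (\<forall>a\<in>circle. \<forall>x\<in>V. \<forall>z. H (act a x, z) = H (x, a * z)) \<and>
           (\<forall>x\<in>V. (h \<circ> cut_map M act) x = H (x, complex_of_real (sqrt (f x)))))}"

end

theory Submission
  imports Defs
begin

text \<open>In a chart around a boundary point a boundary defining function is, by Hadamard's lemma, the
  product of the normal coordinate and a smooth positive function. Hence \<open>f\<^sub>1 = g f\<^sub>2\<close> with \<open>g\<close>
  smooth and positive up to the boundary. The function \<open>g\<close> is invariant near the boundary, because
  it is so in the interior, which is dense, and it is continuous. Therefore
  \<open>H(x, \<surd>f\<^sub>1(x)) = H'(x, \<surd>f\<^sub>2(x))\<close> where \<open>H'(x, z) = H(x, \<surd>g(x) z)\<close> is again smooth and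
  equivariant.\<close>

section \<open>Calculus of smooth functions on open sets\<close>

text \<open>The obstacle is the square root: \<open>sqrt (f x)\<close> is in general not smooth at
  the boundary, so a change of \<open>f\<close> cannot simply be absorbed into the first argument of
  \<open>H\<close>. The quotient of the two roots is harmless, because \<open>g\<close> is positive
  and the square root is smooth away from zero. Multiplication by the real number
  \<open>sqrt (g x)\<close> commutes with rotation of the complex variable, so equivariance survives
  once \<open>g\<close> is constant along orbits. Smoothness is expressed by extensions to open sets
  of a Euclidean space that may be larger than the model space. Such an extension is known to vanish
  only on the part of the boundary hyperplane inside the model space, so Hadamard's lemma keeps the
  value at the projected point. Its use also requires every chart to show the boundary as the
  hyperplane, although membership in the boundary refers to some chart. Nonnegativity of
  \<open>f\<close> and its nonzero differential give this without the inverse function theorem or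
  invariance of domain.\<close>

lemma Ck_open_subset: "Ck_open k S f \<Longrightarrow> T \<subseteq> S \<Longrightarrow> Ck_open k T f"
proof (induction k arbitrary: f)
  case 0
  then show ?case by (auto intro: continuous_on_subset)
next
  case (Suc k)
  then show ?case by auto
qed

lemma Ck_open_imp_continuous_on: "Ck_open k S f \<Longrightarrow> continuous_on S f"
  by (cases k) (auto intro!: continuous_at_imp_continuous_on differentiable_imp_continuous_within)

lemma Ck_open_SucD: "Ck_open (Suc k) S f \<Longrightarrow> Ck_open k S f"
proof (induction k arbitrary: f)
  case 0
  then show ?case using Ck_open_imp_continuous_on[OF 0] by simp
next
  case (Suc k)
  then show ?case by simp
qed

lemma Ck_open_cong:
  assumes "open S" "\<And>x. x \<in> S \<Longrightarrow> f x = g x" "Ck_open k S f"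
  shows "Ck_open k S g"
  using assms(2,3)
proof (induction k arbitrary: f g)
  case 0
  then show ?case by (simp cong: continuous_on_cong_simp)
next
  case (Suc k)
  have diff: "g differentiable (at x)" if "x \<in> S" for x
    using Suc.prems that \<open>open S\<close> unfolding differentiable_def
    by (metis Ck_open.simps(2) differentiable_def has_derivative_transform_within_open)
  have "frechet_derivative f (at x) = frechet_derivative g (at x)" if "x \<in> S" for x
    using Suc.prems that \<open>open S\<close> by (intro frechet_derivative_transform_within_open[of _ _ S]) auto
  then have "frechet_derivative f (at x) v = frechet_derivative g (at x) v" if "x \<in> S" for x v
    using that by simp
  from Suc.IH[OF this] have "Ck_open k S (\<lambda>x. frechet_derivative g (at x) v)" for v
    using Suc.prems(2) by simp
  with diff show ?case by simp
qed

text \<open>Lets an explicit derivative formula replace \<open>frechet_derivative\<close>, so that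
  each closure property below becomes an induction on the order with one differentiation
  rule.\<close>

lemma Ck_open_SucI:
  assumes "open S" "\<And>x. x \<in> S \<Longrightarrow> (f has_derivative D x) (at x)"
    and "\<And>v. Ck_open k S (\<lambda>x. D x v)"
  shows "Ck_open (Suc k) S f"
proof -
  have "D x = frechet_derivative f (at x)" if "x \<in> S" for x
    using assms(2)[OF that] by (rule frechet_derivative_at)
  then have "D x v = frechet_derivative f (at x) v" if "x \<in> S" for x v
    using that by simp
  from Ck_open_cong[OF \<open>open S\<close> this assms(3)]
  have "Ck_open k S (\<lambda>x. frechet_derivative f (at x) v)" for v .
  then show ?thesis using assms(2) by (auto simp: differentiable_def)
qed

lemma Ck_open_SucE:
  assumes "Ck_open (Suc k) S f" "x \<in> S"
  shows "(f has_derivative frechet_derivative f (at x)) (at x)"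
  using assms by (simp add: frechet_derivative_works)

lemma Ck_open_const: "open S \<Longrightarrow> Ck_open k S (\<lambda>x. c)"
proof (induction k arbitrary: c)
  case (Suc k)
  then show ?case by (intro Ck_open_SucI[where D="\<lambda>_ _. 0"]) auto
qed simp

lemma Ck_open_linear:
  assumes "bounded_linear L" "open S"
  shows "Ck_open k S L"
proof (cases k)
  case 0
  then show ?thesis using assms by (simp add: linear_continuous_on)
next
  case (Suc j)
  then show ?thesis
    using assms by (auto intro!: Ck_open_SucI[where D="\<lambda>_. L"] Ck_open_const
        bounded_linear_imp_has_derivative simp del: Ck_open.simps)
qed

lemma Ck_open_add:
  assumes "open S" "Ck_open k S f" "Ck_open k S g"
  shows "Ck_open k S (\<lambda>x. f x + g x)"
  using assms(2,3)
proof (induction k arbitrary: f g)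
  case 0
  then show ?case by (simp add: continuous_intros)
next
  case (Suc k)
  show ?case
    by (rule Ck_open_SucI[OF \<open>open S\<close> has_derivative_add[OF Suc.prems[THEN Ck_open_SucE]]])
      (use Suc in auto)
qed

lemma Ck_open_sum:
  assumes "open S" "finite I" "\<And>i. i \<in> I \<Longrightarrow> Ck_open k S (f i)"
  shows "Ck_open k S (\<lambda>x. \<Sum>i\<in>I. f i x)"
  using assms(2,3)
  by (induction I rule: finite_induct) (auto intro: Ck_open_const Ck_open_add \<open>open S\<close>)

lemma Ck_open_scaleR:
  assumes "open S" "Ck_open k S s" "Ck_open k S f"
  shows "Ck_open k S (\<lambda>x. s x *\<^sub>R f x)"
  using assms(2,3)
proof (induction k arbitrary: s f)
  case 0
  then show ?case by (simp add: continuous_intros)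
next
  case (Suc k)
  show ?case
    by (rule Ck_open_SucI[OF \<open>open S\<close> has_derivative_scaleR[OF Suc.prems[THEN Ck_open_SucE]]])
      (use Suc.prems Suc.prems[THEN Ck_open_SucD] in
        \<open>simp_all add: Ck_open_add \<open>open S\<close> Suc.IH\<close>)
qed

lemma Ck_open_mult:
  fixes f g :: "'a::euclidean_space \<Rightarrow> real"
  shows "open S \<Longrightarrow> Ck_open k S f \<Longrightarrow> Ck_open k S g \<Longrightarrow> Ck_open k S (\<lambda>x. f x * g x)"
  using Ck_open_scaleR[of S k f g] by simp

text \<open>The derivative of the reciprocal contains the reciprocal again, so the induction
  hypothesis supplies this factor one order lower. The square root below is treated in the same
  way.\<close>

lemma Ck_open_inverse:
  fixes f :: "'a::euclidean_space \<Rightarrow> real"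
  assumes "open S" "\<And>x. x \<in> S \<Longrightarrow> f x \<noteq> 0" "Ck_open k S f"
  shows "Ck_open k S (\<lambda>x. inverse (f x))"
  using assms(3)
proof (induction k)
  case 0
  then show ?case using assms(2) by (simp add: continuous_on_inverse)
next
  case (Suc k)
  have i: "Ck_open k S (\<lambda>x. inverse (f x))"
    using Suc Ck_open_SucD by blast
  show ?case
  proof (rule Ck_open_SucI[OF \<open>open S\<close>])
    fix x assume "x \<in> S"
    then show "((\<lambda>x. inverse (f x)) has_derivative
        (\<lambda>v. (- 1 * (inverse (f x) * inverse (f x))) * frechet_derivative f (at x) v)) (at x)"
      using Deriv.has_derivative_inverse[OF _ Ck_open_SucE[OF Suc.prems]] assms(2)
      by (simp add: algebra_simps)
  next
    fix v
    show "Ck_open k S (\<lambda>x. (- 1 * (inverse (f x) * inverse (f x))) * frechet_derivative f (at x) v)"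
      using Suc.prems by (intro Ck_open_mult i Ck_open_const \<open>open S\<close>) auto
  qed
qed

lemma Ck_open_sqrt:
  fixes f :: "'a::euclidean_space \<Rightarrow> real"
  assumes "open S" "\<And>x. x \<in> S \<Longrightarrow> f x > 0" "Ck_open k S f"
  shows "Ck_open k S (\<lambda>x. sqrt (f x))"
  using assms(3)
proof (induction k)
  case 0
  then show ?case by (simp add: continuous_intros)
next
  case (Suc k)
  have i: "Ck_open k S (\<lambda>x. sqrt (f x))"
    using Suc Ck_open_SucD by blast
  show ?case
  proof (rule Ck_open_SucI[OF \<open>open S\<close>])
    fix x assume "x \<in> S"
    then show "((\<lambda>x. sqrt (f x)) has_derivative
        (\<lambda>v. inverse (2 * sqrt (f x)) * frechet_derivative f (at x) v)) (at x)"
      using has_derivative_real_sqrt[OF _ Ck_open_SucE[OF Suc.prems]] assms(2)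
      by (simp add: field_simps)
  next
    fix v
    show "Ck_open k S (\<lambda>x. inverse (2 * sqrt (f x)) * frechet_derivative f (at x) v)"
      using Suc.prems assms(2)
      by (intro Ck_open_mult Ck_open_inverse i Ck_open_const \<open>open S\<close>) force+
  qed
qed

lemma Ck_open_inner_left:
  assumes "open S" "Ck_open k S f"
  shows "Ck_open k S (\<lambda>x. f x \<bullet> b)"
  using assms(2)
proof (induction k arbitrary: f)
  case 0
  then show ?case by (simp add: continuous_intros)
next
  case (Suc k)
  show ?case
    by (rule Ck_open_SucI[OF \<open>open S\<close> has_derivative_inner_left[OF Ck_open_SucE[OF Suc.prems]]])
      (use Suc in auto)
qed

text \<open>In the chain rule the derivative of \<open>g\<close> is applied to a direction that
  varies with \<open>x\<close>, whereas \<open>Ck_open\<close> controls derivatives in fixed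
  directions only. Expanding the direction in \<open>Basis\<close> separates the two dependences
  into sums of products.\<close>

lemma Ck_open_compose:
  assumes "open S" "open T" "f ` S \<subseteq> T" "Ck_open k S f" "Ck_open k T g"
  shows "Ck_open k S (\<lambda>x. g (f x))"
  using assms(4,5)
proof (induction k arbitrary: g)
  case 0
  then show ?case using assms(3) by (auto intro: continuous_on_compose2)
next
  case (Suc k)
  have f: "Ck_open k S f" using Suc.prems Ck_open_SucD by blast
  let ?D = "\<lambda>x v. \<Sum>b\<in>Basis. (frechet_derivative f (at x) v \<bullet> b) *\<^sub>R frechet_derivative g (at (f x)) b"
  show ?case
  proof (rule Ck_open_SucI[OF \<open>open S\<close>])
    fix x assume x: "x \<in> S"
    have g: "(g has_derivative frechet_derivative g (at (f x))) (at (f x))"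
      using Suc.prems(2) Ck_open_SucE x assms(3) by blast
    interpret linear "frechet_derivative g (at (f x))"
      using g by (rule has_derivative_linear)
    have "frechet_derivative g (at (f x)) (frechet_derivative f (at x) v) = ?D x v" for v
      by (subst (2) euclidean_representation[symmetric]) (simp add: sum scale)
    then show "((\<lambda>x. g (f x)) has_derivative ?D x) (at x)"
      using has_derivative_compose[OF Ck_open_SucE[OF Suc.prems(1) x] g] by simp
  next
    fix v
    have "Ck_open k S (\<lambda>x. frechet_derivative f (at x) v \<bullet> b)" for b
      using Suc.prems by (intro Ck_open_inner_left \<open>open S\<close>) auto
    then show "Ck_open k S (\<lambda>x. ?D x v)"
      using Suc.prems(2) by (intro Ck_open_sum Ck_open_scaleR Suc.IH f \<open>open S\<close>) auto
  qed
qed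

lemma Ck_open_Pair:
  assumes "open S" "Ck_open k S f" "Ck_open k S g"
  shows "Ck_open k S (\<lambda>x. (f x, g x))"
  using assms(2,3)
proof (induction k arbitrary: f g)
  case 0
  then show ?case by (simp add: continuous_on_Pair)
next
  case (Suc k)
  show ?case
    by (rule Ck_open_SucI[OF \<open>open S\<close> has_derivative_Pair[OF Suc.prems[THEN Ck_open_SucE]]])
      (use Suc in auto)
qed

section \<open>Integrals with a parameter and Hadamard's lemma\<close>

lemma Ck_open_integral:
  fixes G :: "'a::euclidean_space \<times> real \<Rightarrow> real"
  assumes "open S" "open U" "U \<times> {0..1} \<subseteq> S" "Ck_open k S G"
  shows "Ck_open k U (\<lambda>y. integral {0..1} (\<lambda>t. G (y, t)))"
  using assms(4)
proof (induction k arbitrary: G)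
  case 0
  then have "continuous_on (U \<times> cbox 0 1) (\<lambda>(y, t). G (y, t))"
    using assms(3) by (auto intro: continuous_on_subset)
  then show ?case
    using integral_continuous_on_param[of U 0 1 "\<lambda>y t. G (y, t)"] by simp
next
  case (Suc k)
  define G' where "G' = (\<lambda>y t v. frechet_derivative G (at (y, t)) (v, 0))"
  have der: "((\<lambda>y. G (y, t)) has_derivative G' y t) (at y)" if "y \<in> U" "t \<in> {0..1}" for y t
  proof -
    have "(y, t) \<in> S" using that assms(3) by auto
    then have G: "(G has_derivative frechet_derivative G (at (y, t))) (at (y, t))"
      using Suc.prems Ck_open_SucE by blast
    have "((\<lambda>y. (y, t)) has_derivative (\<lambda>v. (v, 0))) (at y)"
      by (auto intro!: derivative_eq_intros)
    from has_derivative_compose[OF this G] show ?thesis by (simp add: G'_def)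
  qed
  \<comment> \<open>The Leibniz rule asks for a derivative that is continuous as a map into bounded
    linear operators. In finite dimension this follows from continuity in each fixed direction,
    which is what \<open>Ck_open\<close> provides.\<close>
  define B where "B = (\<lambda>y t. Blinfun (G' y t))"
  have B: "blinfun_apply (B y t) = G' y t" if "y \<in> U" "t \<in> {0..1}" for y t
    using der[OF that] unfolding B_def
    by (intro bounded_linear_Blinfun_apply has_derivative_bounded_linear)
  have dG: "Ck_open k S (\<lambda>z. frechet_derivative G (at z) (v, 0))" for v
    using Suc.prems by simp
  have "continuous_on S (\<lambda>z. frechet_derivative G (at z) (v, 0))" for v
    using dG by (rule Ck_open_imp_continuous_on)
  then have "continuous_on (U \<times> cbox 0 1) (\<lambda>z. frechet_derivative G (at z) (v, 0))" for v
    by (rule continuous_on_subset) (use assms(3) in simp)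
  moreover have "frechet_derivative G (at z) (v, 0) = blinfun_apply (case z of (y, t) \<Rightarrow> B y t) v"
    if "z \<in> U \<times> cbox 0 1" for z v
    using that B by (auto simp: G'_def)
  ultimately have "continuous_on (U \<times> cbox 0 1) (\<lambda>z. blinfun_apply (case z of (y, t) \<Rightarrow> B y t) v)" for v
    by (metis (no_types, lifting) continuous_on_cong)
  then have contB: "continuous_on (U \<times> cbox 0 1) (\<lambda>(y, t). B y t)"
    by (intro continuous_on_blinfun_componentwise)
  show ?case
  proof (rule Ck_open_SucI[OF \<open>open U\<close>])
    fix v
    show "Ck_open k U (\<lambda>y. integral {0..1} (\<lambda>t. frechet_derivative G (at (y, t)) (v, 0)))"
      using Suc.IH[OF dG] .
  next
    fix y assume y: "y \<in> U"
    obtain e where e: "e > 0" "ball y e \<subseteq> U"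
      using \<open>open U\<close> y open_contains_ball by blast
    have intG: "(\<lambda>t. G (y', t)) integrable_on cbox 0 1" if "y' \<in> U" for y'
      by (intro integrable_continuous continuous_on_compose2[OF Ck_open_imp_continuous_on[OF Suc.prems]]
          continuous_intros) (use that assms(3) in auto)
    \<comment> \<open>The Leibniz rule needs a convex parameter set, hence the passage to a ball
      around \<open>y\<close>.\<close>
    have contB': "continuous_on (ball y e \<times> cbox 0 1) (\<lambda>(y, t). B y t)"
      using contB by (rule continuous_on_subset) (use e in auto)
    have "((\<lambda>y. integral (cbox 0 1) (\<lambda>t. G (y, t))) has_derivative integral (cbox 0 1) (B y))
        (at y within ball y e)"
    proof (rule leibniz_rule)
      fix y' t assume *: "y' \<in> ball y e" "t \<in> cbox (0::real) 1"
      then have "y' \<in> U" using e by blast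
      with * show "((\<lambda>y. G (y, t)) has_derivative blinfun_apply (B y' t)) (at y' within ball y e)"
        using * B[of y' t] der[of y' t] has_derivative_at_withinI by auto
    qed (use e intG contB' in auto)
    then have 1: "((\<lambda>y. integral {0..1} (\<lambda>t. G (y, t))) has_derivative integral {0..1} (B y)) (at y)"
      using e by (simp add: at_within_open[OF centre_in_ball[THEN iffD2]])
    have "continuous_on (cbox 0 1) (B y)"
      using continuous_on_compose2[OF contB continuous_on_Pair[OF continuous_on_const continuous_on_id]] y
      by auto
    then have "B y integrable_on {0..1}"
      using integrable_continuous[of 0 1 "B y"] by simp
    then have "blinfun_apply (integral {0..1} (B y)) v = integral {0..1} (\<lambda>t. blinfun_apply (B y t) v)"
      for v
      by (rule blinfun_apply_integral)
    moreover have "integral {0..1} (\<lambda>t. blinfun_apply (B y t) v) =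
        integral {0..1} (\<lambda>t. frechet_derivative G (at (y, t)) (v, 0))" for v
      by (rule integral_cong) (simp add: B[OF y] G'_def)
    ultimately have "blinfun_apply (integral {0..1} (B y)) =
        (\<lambda>v. integral {0..1} (\<lambda>t. frechet_derivative G (at (y, t)) (v, 0)))"
      by (intro ext) simp
    then show "((\<lambda>y. integral {0..1} (\<lambda>t. G (y, t))) has_derivative
        (\<lambda>v. integral {0..1} (\<lambda>t. frechet_derivative G (at (y, t)) (v, 0)))) (at y)"
      using 1 by simp
  qed
qed

text \<open>Integrating the derivative of \<open>F\<close> along the segment from the projection of
  \<open>y\<close> onto the orthogonal complement of \<open>n\<close> up to \<open>y\<close> gives
  the increment of \<open>F\<close>, and the length of the segment contributes the factor
  \<open>n \<bullet> y\<close>. For \<open>n = 0\<close> division by zero makes the projection the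
  identity and the formula trivial.\<close>

lemma Hadamard_lemma:
  fixes F :: "'a::euclidean_space \<Rightarrow> real"
  assumes "open W" "p \<in> W" "n \<bullet> p = 0" and F: "\<And>k. Ck_open k W F"
  obtains U q where "open U" "p \<in> U" "U \<subseteq> W" "\<And>k. Ck_open k U q"
    "\<And>y. y \<in> U \<Longrightarrow> y - ((n \<bullet> y) / (n \<bullet> n)) *\<^sub>R n \<in> W"
    "\<And>y. y \<in> U \<Longrightarrow> F y = F (y - ((n \<bullet> y) / (n \<bullet> n)) *\<^sub>R n) + (n \<bullet> y) * q y"
proof -
  define c where "c y = (n \<bullet> y) / (n \<bullet> n)" for y
  define P where "P y = y - c y *\<^sub>R n" for y
  define L where "L z = P (fst z) + (snd z * c (fst z)) *\<^sub>R n" for z :: "'a \<times> real"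
  obtain e where e: "e > 0" "ball p e \<subseteq> W"
    using \<open>open W\<close> \<open>p \<in> W\<close> open_contains_ball by blast
  have blc: "bounded_linear c"
    unfolding c_def divide_inverse
    by (intro bounded_linear_mult_const bounded_linear_inner_right)
  have blP: "bounded_linear P"
    unfolding P_def
    by (intro bounded_linear_sub bounded_linear_ident bounded_linear_scaleR_const blc)
  \<comment> \<open>With \<open>y\<close> and its projection in the same ball, convexity keeps the
    segment between them inside \<open>W\<close>.\<close>
  define U where "U = ball p e \<inter> P -` ball p e"
  have "open U"
    unfolding U_def by (intro open_Int open_vimage linear_continuous_on blP) auto
  have "p \<in> U" using e \<open>n \<bullet> p = 0\<close> by (simp add: U_def P_def c_def)
  have Lsmooth: "Ck_open k UNIV L" for k
    unfolding L_def
    by (intro Ck_open_add Ck_open_scaleR Ck_open_mult Ck_open_const Ck_open_linear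
        bounded_linear_compose[OF blP] bounded_linear_compose[OF blc] bounded_linear_fst bounded_linear_snd
        open_UNIV)
  define S where "S = L -` W"
  have "open S"
    unfolding S_def using Ck_open_imp_continuous_on[OF Lsmooth] \<open>open W\<close> by (intro open_vimage)
  have inball: "L (y, t) \<in> ball p e" if "y \<in> U" "t \<in> {0..1}" for y t
  proof -
    have "L (y, t) = (1 - t) *\<^sub>R P y + t *\<^sub>R y"
      by (simp add: L_def P_def algebra_simps)
    then show ?thesis
      using that convexD_alt[OF convex_ball, of "P y" p e y t] by (auto simp: U_def)
  qed
  define G where "G z = frechet_derivative F (at (L z)) n" for z
  have G: "Ck_open k S G" for k
    unfolding G_def
    using F[of "Suc k"]
    by (intro Ck_open_compose[OF \<open>open S\<close> \<open>open W\<close> _ Ck_open_subset[OF Lsmooth]]) (auto simp: S_def)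
  \<comment> \<open>The velocity of the segment is \<open>c y *\<^sub>R n\<close>; the denominator
    of \<open>c y\<close> becomes the constant in front of the integral.\<close>
  define q where "q y = inverse (n \<bullet> n) * integral {0..1} (\<lambda>t. G (y, t))" for y
  show ?thesis
  proof
    show "open U" "p \<in> U" by fact+
    show "U \<subseteq> W" using e by (auto simp: U_def)
    show "Ck_open k U q" for k
      unfolding q_def
      by (intro Ck_open_mult Ck_open_const \<open>open U\<close> Ck_open_integral[OF \<open>open S\<close> _ _ G])
        (use inball e(2) in \<open>force simp: S_def simp del: mem_ball\<close>)
    fix y assume y: "y \<in> U"
    show "y - ((n \<bullet> y) / (n \<bullet> n)) *\<^sub>R n \<in> W"
      using y e by (auto simp: U_def P_def c_def)
    have "((\<lambda>t. F (L (y, t))) has_vector_derivative c y * G (y, t)) (at t within {0..1})"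
      if t: "t \<in> {0..1}" for t
    proof -
      have FL: "(F has_derivative frechet_derivative F (at (L (y, t)))) (at (L (y, t)))"
        using inball[OF y t] e Ck_open_SucE[OF F] by blast
      have "((\<lambda>t. L (y, t)) has_derivative (\<lambda>s. (s * c y) *\<^sub>R n)) (at t within {0..1})"
        unfolding L_def by (auto intro!: derivative_eq_intros)
      from has_derivative_compose[OF this FL] linear_scale[OF has_derivative_linear[OF FL]]
      show ?thesis
        by (simp add: has_vector_derivative_def G_def mult_ac)
    qed
    then have "((\<lambda>t. c y * G (y, t)) has_integral F (L (y, 1)) - F (L (y, 0))) {0..1}"
      by (intro fundamental_theorem_of_calculus) auto
    then have "F (L (y, 1)) - F (L (y, 0)) = c y * integral {0..1} (\<lambda>t. G (y, t))"
      by (metis integral_mult_right integral_unique)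
    then have "F y - F (P y) = (n \<bullet> y) * q y"
      by (simp add: L_def P_def q_def c_def divide_inverse mult_ac)
    then show "F y = F (y - ((n \<bullet> y) / (n \<bullet> n)) *\<^sub>R n) + (n \<bullet> y) * q y"
      by (simp add: P_def c_def)
  qed
qed

section \<open>Boundary defining functions in charts\<close>

text \<open>A derivative within \<open>S\<close> can be tested only along rays that stay in
  \<open>S\<close>. Composition over the parameter set \<open>A\<close> turns it into a derivative
  in one real variable, and by hypothesis \<open>A\<close> contains all small positive
  parameters.\<close>

lemma tendsto_directional_derivative:
  fixes f :: "'a::euclidean_space \<Rightarrow> real"
  assumes "(f has_derivative D) (at p within S)"
    and "\<forall>\<^sub>F t in at_right 0. p + t *\<^sub>R v \<in> S"
  shows "((\<lambda>t. (f (p + t *\<^sub>R v) - f p) / t) \<longlongrightarrow> D v) (at_right 0)"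
proof -
  define A where "A = {t. 0 < t \<and> p + t *\<^sub>R v \<in> S}"
  have "((\<lambda>t. p + t *\<^sub>R v) has_derivative (\<lambda>t. t *\<^sub>R v)) (at 0 within A)"
    by (auto intro!: derivative_eq_intros)
  moreover have "(f has_derivative D) (at (p + 0 *\<^sub>R v) within (\<lambda>t. p + t *\<^sub>R v) ` A)"
    using assms(1) by (auto simp: A_def intro: has_derivative_subset)
  ultimately have "((\<lambda>t. f (p + t *\<^sub>R v)) has_derivative (\<lambda>t. D (t *\<^sub>R v))) (at 0 within A)"
    by (rule has_derivative_in_compose)
  moreover have "D (t *\<^sub>R v) = D v * t" for t
    using linear_scale[OF has_derivative_linear[OF assms(1)]] by simp
  ultimately have "((\<lambda>t. f (p + t *\<^sub>R v)) has_field_derivative D v) (at 0 within A)"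
    by (simp add: has_field_derivative_def)
  then have "((\<lambda>t. (f (p + t *\<^sub>R v) - f p) / t) \<longlongrightarrow> D v) (at 0 within A)"
    by (simp add: has_field_derivative_iff)
  moreover have "at_right 0 \<le> at 0 within A"
  proof (rule filter_leI)
    fix Q assume "\<forall>\<^sub>F t in at 0 within A. Q t"
    with assms(2) show "\<forall>\<^sub>F t in at_right 0. Q t"
      unfolding eventually_at_filter by eventually_elim (auto simp: A_def)
  qed
  ultimately show ?thesis
    using tendsto_mono by blast
qed

section \<open>Charts, the half-space model and boundary points\<close>

locale bd_mfd =
  fixes M :: "('a, 'e::euclidean_space) bd_manifold"
  assumes mfd: "manifold_with_boundary M"
begin

abbreviation X where "X \<equiv> space_of M"
abbreviation E where "E \<equiv> model_space M"
abbreviation n where "n \<equiv> inward M"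
abbreviation bdry where "bdry \<equiv> mfd_boundary M"

lemma subspace_E: "subspace E" and n_in_E: "n \<in> E"
  using mfd by (auto simp: manifold_with_boundary_def)

lemma chart_exists:
  assumes "x \<in> topspace X"
  obtains W \<phi> where "(W, \<phi>) \<in> charts M" "x \<in> W"
proof -
  have "(\<Union>(W, \<phi>)\<in>charts M. W) = topspace X"
    using mfd by (auto simp: manifold_with_boundary_def)
  with assms that show ?thesis by blast
qed

lemma charts_props:
  assumes "(W, \<phi>) \<in> charts M"
  shows chart_open: "openin X W"
    and chart_image: "openin (top_of_set (half_space M)) (\<phi> ` W)"
    and chart_homeo: "homeomorphic_map (subtopology X W) (top_of_set (\<phi> ` W)) \<phi>"
  using mfd assms by (auto simp: manifold_with_boundary_def)

lemma chart_inj: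
  assumes "(W, \<phi>) \<in> charts M"
  shows "inj_on \<phi> W"
  using homeomorphic_imp_injective_map[OF chart_homeo[OF assms]]
    openin_subset[OF chart_open[OF assms]]
  by (simp add: inf.absorb2)

lemma chart_continuous:
  assumes "(W, \<phi>) \<in> charts M"
  shows "continuous_map (subtopology X W) euclidean \<phi>"
  using homeomorphic_imp_continuous_map[OF chart_homeo[OF assms]] continuous_map_in_subtopology
  by blast

lemma chart_preimage_open:
  assumes "(W, \<phi>) \<in> charts M" "open B"
  shows "openin X {x \<in> W. \<phi> x \<in> B}"
proof -
  have "openin (subtopology X W) {x \<in> topspace (subtopology X W). \<phi> x \<in> B}"
    by (rule openin_continuous_map_preimage[OF chart_continuous[OF assms(1)]]) (use assms in simp)
  moreover have "topspace (subtopology X W) = W"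
    using openin_subset[OF chart_open[OF assms(1)]] by (simp add: inf.absorb2)
  ultimately show ?thesis
    using chart_open[OF assms(1)] openin_trans_full by fastforce
qed

lemma chart_image_open:
  assumes "(W, \<phi>) \<in> charts M" "openin X O'"
  shows "openin (top_of_set (half_space M)) (\<phi> ` (W \<inter> O'))"
proof -
  have "openin (subtopology X W) (W \<inter> O')"
    using assms(2) by (simp add: openin_subtopology_Int2)
  then have "openin (top_of_set (\<phi> ` W)) (\<phi> ` (W \<inter> O'))"
    using homeomorphic_imp_open_map[OF chart_homeo[OF assms(1)]] by (simp add: open_map_def)
  then show ?thesis
    using chart_image[OF assms(1)] openin_trans by blast
qed

lemma boundary_subset: "bdry \<subseteq> topspace X"
  unfolding mfd_boundary_def using chart_open openin_subset by fastforce

text \<open>Where the normal coordinate is positive, continuity keeps it positive in every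
  direction. On the hyperplane it changes linearly, so the sign of \<open>n \<bullet> v\<close>
  decides. For \<open>n = 0\<close> the sign condition holds for all \<open>v\<close>.\<close>

lemma ray_in_half_space:
  assumes S: "openin (top_of_set (half_space M)) S" and "p \<in> S" "v \<in> E" "n \<bullet> p = 0 \<Longrightarrow> 0 \<le> n \<bullet> v"
  shows "\<forall>\<^sub>F t in at_right 0. p + t *\<^sub>R v \<in> S"
proof -
  obtain T where T: "open T" "S = half_space M \<inter> T"
    using S by (auto simp: openin_open)
  have p: "p \<in> E" "0 \<le> n \<bullet> p" "p \<in> T"
    using \<open>p \<in> S\<close> T by (auto simp: half_space_def)
  have lim: "((\<lambda>t. p + t *\<^sub>R v) \<longlongrightarrow> p) (at_right 0)"
    by (auto intro!: tendsto_eq_intros)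
  then have "\<forall>\<^sub>F t in at_right 0. p + t *\<^sub>R v \<in> T"
    using T p topological_tendstoD by blast
  moreover have "\<forall>\<^sub>F t in at_right 0. 0 \<le> n \<bullet> (p + t *\<^sub>R v)"
  proof (cases "n \<bullet> p = 0")
    case True
    then show ?thesis
      using assms(4) eventually_at_right_less[of "0::real"]
      by (auto elim!: eventually_mono simp: inner_right_distrib)
  next
    case False
    then have "n \<bullet> p > 0" using p by simp
    with tendsto_inner[OF tendsto_const lim] have "\<forall>\<^sub>F t in at_right 0. 0 < n \<bullet> (p + t *\<^sub>R v)"
      by (rule order_tendstoD)
    then show ?thesis by eventually_elim simp
  qed
  ultimately show ?thesis
  proof eventually_elim
    case (elim t)
    have "p + t *\<^sub>R v \<in> E"
      using subspace_E p(1) \<open>v \<in> E\<close> by (intro subspace_add subspace_scale)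
    then show ?case using elim T by (simp add: half_space_def)
  qed
qed

text \<open>Invariance near the boundary is dropped here, since the local structure of a boundary
  defining function does not involve the circle action.\<close>

definition bdf :: "('a \<Rightarrow> real) \<Rightarrow> bool" where
  "bdf f \<longleftrightarrow> (\<forall>x\<in>topspace X. 0 \<le> f x) \<and> smooth_fun M (topspace X) f \<and>
     {x \<in> topspace X. f x = 0} = bdry \<and> (\<forall>x\<in>bdry. nonzero_differential_at M f x)"

lemma bdf_zero_iff: "bdf f \<Longrightarrow> x \<in> topspace X \<Longrightarrow> f x = 0 \<longleftrightarrow> x \<in> bdry"
  by (auto simp: bdf_def)

lemma bdf_pos: "bdf f \<Longrightarrow> x \<in> topspace X \<Longrightarrow> x \<notin> bdry \<Longrightarrow> 0 < f x"
  using bdf_zero_iff[of f x] by (fastforce simp: bdf_def)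

lemma bdf_local_extension:
  assumes "bdf f" "(W, \<phi>) \<in> charts M" "x \<in> W"
  obtains T F where "open T" "\<phi> x \<in> T" "\<And>k. Ck_open k T F"
    "\<And>y. y \<in> \<phi> ` W \<Longrightarrow> y \<in> T \<Longrightarrow> F y = f (inv_into W \<phi> y)"
proof -
  have "W \<inter> topspace X = W"
    using openin_subset[OF chart_open[OF assms(2)]] by blast
  moreover have "smooth_fun M (topspace X) f"
    using assms(1) by (simp add: bdf_def)
  ultimately have "smooth_on (\<phi> ` W) (\<lambda>y. f (inv_into W \<phi> y))"
    using assms(2) unfolding smooth_fun_def by (metis (no_types, lifting) case_prodD)
  then show ?thesis
    using assms(3) that unfolding smooth_on_def by (metis Int_iff imageI)
qed

text \<open>As \<open>f\<close> vanishes on the boundary and is nonnegative, its differential there is nonnegative on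
  all tangent directions that stay in the manifold. Hence it would vanish if the chart mapped the
  point to the interior of the half-space; this makes the boundary independent of the chart.\<close>

lemma boundary_in_chart:
  assumes f: "bdf f" and "(W, \<phi>) \<in> charts M" "x \<in> W" "x \<in> bdry"
  obtains d where "\<phi> x \<in> half_space_boundary M" "d > 0"
    "((\<lambda>t. f (inv_into W \<phi> (\<phi> x + t *\<^sub>R n)) / t) \<longlongrightarrow> d) (at_right 0)"
proof -
  define g where "g y = f (inv_into W \<phi> y)" for y
  define p where "p = \<phi> x"
  have W: "W \<subseteq> topspace X" using openin_subset[OF chart_open[OF assms(2)]] .
  have p: "p \<in> \<phi> ` W" using \<open>x \<in> W\<close> by (simp add: p_def)
  have "nonzero_differential_at M f x"
    using f \<open>x \<in> bdry\<close> by (simp add: bdf_def)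
  then obtain D w where D: "(g has_derivative D) (at p within \<phi> ` W)" and w: "w \<in> E" "D w \<noteq> 0"
    using assms(2,3) unfolding nonzero_differential_at_def g_def p_def by blast
  interpret D: linear D using D by (rule has_derivative_linear)
  have gp: "g p = 0"
    using bdf_zero_iff[OF f] \<open>x \<in> bdry\<close> \<open>x \<in> W\<close> W chart_inj[OF assms(2)]
    by (auto simp: g_def p_def)
  have g0: "g y \<ge> 0" if "y \<in> \<phi> ` W" for y
    using f W inv_into_into[OF that] by (auto simp: g_def bdf_def)
  have ray: "\<forall>\<^sub>F t in at_right 0. p + t *\<^sub>R v \<in> \<phi> ` W" if "v \<in> E" "n \<bullet> p = 0 \<Longrightarrow> 0 \<le> n \<bullet> v" for v
    using ray_in_half_space[OF chart_image[OF assms(2)] p that] .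
  have lim: "((\<lambda>t. g (p + t *\<^sub>R v) / t) \<longlongrightarrow> D v) (at_right 0)"
    if "v \<in> E" "n \<bullet> p = 0 \<Longrightarrow> 0 \<le> n \<bullet> v" for v
    using tendsto_directional_derivative[OF D ray[OF that]] by (simp add: gp)
  have nonneg: "D v \<ge> 0" if "v \<in> E" "n \<bullet> p = 0 \<Longrightarrow> 0 \<le> n \<bullet> v" for v
  proof (rule tendsto_lowerbound[OF lim[OF that]])
    show "\<forall>\<^sub>F t in at_right 0. 0 \<le> g (p + t *\<^sub>R v) / t"
      using eventually_conj[OF ray[OF that] eventually_at_right_less[of "0::real"]]
      by (rule eventually_mono) (use g0 in auto)
  qed auto
  have tangent: "D v = 0" if "v \<in> E" "n \<bullet> p = 0 \<Longrightarrow> n \<bullet> v = 0" for v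
    using nonneg[of v] nonneg[of "- v"] that subspace_E by (simp add: subspace_neg D.neg)
  \<comment> \<open>If \<open>n = 0\<close> or \<open>n \<bullet> p \<noteq> 0\<close>, the tangency
    condition holds for every direction, by triviality or vacuously, and \<open>D w\<close> would be
    zero.\<close>
  have nz: "n \<noteq> 0 \<and> n \<bullet> p = 0"
    using tangent[of w] w by auto
  \<comment> \<open>Removing the normal component of \<open>w\<close> leaves a tangential vector,
    which \<open>D\<close> annihilates. So \<open>D w\<close> is a multiple of \<open>D n\<close>,
    and \<open>D n\<close> is the positive limit \<open>d\<close>.\<close>
  define c where "c = (n \<bullet> w) / (n \<bullet> n)"
  have "D (w - c *\<^sub>R n) = 0"
    using nz w(1) n_in_E subspace_E
    by (intro tangent subspace_diff subspace_scale) (auto simp: c_def inner_diff_right)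
  then have "D w = c * D n" by (simp add: D.diff D.scale)
  then have "D n \<noteq> 0" using w by auto
  moreover have "D n \<ge> 0" using nonneg[OF n_in_E] by simp
  ultimately have "D n > 0" by simp
  moreover have "\<phi> x \<in> half_space_boundary M"
    using nz p openin_subset[OF chart_image[OF assms(2)]]
    by (auto simp: half_space_boundary_def half_space_def p_def)
  ultimately show ?thesis
    using that lim[OF n_in_E] by (simp add: g_def p_def)
qed

lemma boundary_iff_chart:
  assumes "bdf f" "(W, \<phi>) \<in> charts M" "x \<in> W"
  shows "x \<in> bdry \<longleftrightarrow> \<phi> x \<in> half_space_boundary M"
proof
  show "x \<in> bdry \<Longrightarrow> \<phi> x \<in> half_space_boundary M"
    using boundary_in_chart[OF assms] by blast
  show "\<phi> x \<in> half_space_boundary M \<Longrightarrow> x \<in> bdry"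
    using assms(2,3) by (auto simp: mfd_boundary_def)
qed

text \<open>A small step along \<open>n\<close> in a chart makes the normal coordinate positive.
  That the new point is off the boundary, whatever chart is used, rests on
  \<open>boundary_iff_chart\<close>. Density is what makes the continuous extension of the quotient
  unique.\<close>

lemma interior_dense:
  assumes f: "bdf f" and "openin X O'" "x \<in> O'"
  obtains y where "y \<in> O'" "y \<notin> bdry"
proof (cases "x \<in> bdry")
  case True
  obtain W \<phi> where ch: "(W, \<phi>) \<in> charts M" "x \<in> W"
    using chart_exists openin_subset[OF assms(2)] assms(3) by blast
  have xb: "n \<noteq> 0" "n \<bullet> \<phi> x = 0"
    using boundary_iff_chart[OF f ch] True by (auto simp: half_space_boundary_def)
  have "\<forall>\<^sub>F t in at_right 0. \<phi> x + t *\<^sub>R n \<in> \<phi> ` (W \<inter> O')"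
    using ch assms(3) n_in_E by (intro ray_in_half_space chart_image_open[OF ch(1) assms(2)]) auto
  with eventually_at_right_less[of "0::real"]
  have "\<forall>\<^sub>F t in at_right 0. 0 < t \<and> \<phi> x + t *\<^sub>R n \<in> \<phi> ` (W \<inter> O')"
    by eventually_elim simp
  then obtain t where t: "0 < t" "\<phi> x + t *\<^sub>R n \<in> \<phi> ` (W \<inter> O')"
    using eventually_happens'[OF trivial_limit_at_right_real] by blast
  then obtain y where y: "y \<in> W" "y \<in> O'" "\<phi> y = \<phi> x + t *\<^sub>R n" by auto
  then have "n \<bullet> \<phi> y > 0" using xb t by (simp add: inner_right_distrib)
  then have "y \<notin> bdry"
    using boundary_iff_chart[OF f ch(1) y(1)] by (auto simp: half_space_boundary_def)
  with y that show ?thesis by blast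
qed (use assms that in blast)

text \<open>The weight, \<open>n \<bullet> y\<close> or \<open>1\<close>, depends on the base point
  \<open>x\<close> but not on \<open>f\<close>, so that it cancels when two such functions are
  compared. Away from the boundary the extension of \<open>f\<close> itself serves as
  \<open>q\<close>.\<close>

lemma bdf_local_form:
  assumes f: "bdf f" and ch: "(W, \<phi>) \<in> charts M" "x \<in> W"
  obtains B q where "open B" "\<phi> x \<in> B" "\<And>k. Ck_open k B q" "\<And>y. y \<in> B \<Longrightarrow> q y > 0"
    "\<And>y. y \<in> \<phi> ` W \<Longrightarrow> y \<in> B \<Longrightarrow> f (inv_into W \<phi> y) = (if x \<in> bdry then n \<bullet> y else 1) * q y"
proof -
  define p where "p = \<phi> x"
  have "\<exists>B q. open B \<and> p \<in> B \<and> (\<forall>k. Ck_open k B q) \<and> q p > 0 \<and>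
    (\<forall>y\<in>\<phi> ` W \<inter> B. f (inv_into W \<phi> y) = (if x \<in> bdry then n \<bullet> y else 1) * q y)"
  proof (cases "x \<in> bdry")
    case False
    obtain T F where T: "open T" "\<phi> x \<in> T" "\<And>k. Ck_open k T F"
      "\<And>y. y \<in> \<phi> ` W \<Longrightarrow> y \<in> T \<Longrightarrow> F y = f (inv_into W \<phi> y)"
      using bdf_local_extension[OF f ch] by blast
    have "F p = f x"
      using T ch chart_inj[OF ch(1)] by (simp add: p_def)
    also have "f x > 0"
      using False ch openin_subset[OF chart_open[OF ch(1)]] by (intro bdf_pos[OF f]) auto
    finally have "F p > 0" .
    with T False show ?thesis
      by (intro exI[of _ T] exI[of _ F]) (auto simp: p_def)
  next
    case True
    obtain T F where T: "open T" "\<phi> x \<in> T" "\<And>k. Ck_open k T F"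
      "\<And>y. y \<in> \<phi> ` W \<Longrightarrow> y \<in> T \<Longrightarrow> F y = f (inv_into W \<phi> y)"
      using bdf_local_extension[OF f ch] by blast
    obtain d where d: "\<phi> x \<in> half_space_boundary M" "d > 0"
      "((\<lambda>t. f (inv_into W \<phi> (\<phi> x + t *\<^sub>R n)) / t) \<longlongrightarrow> d) (at_right 0)"
      using boundary_in_chart[OF f ch True] .
    have n: "n \<noteq> 0" "n \<bullet> p = 0"
      using d(1) by (auto simp: half_space_boundary_def p_def)
    \<comment> \<open>\<open>T'\<close> cuts the chart image out of the half-space. Keeping
      projected points in \<open>T'\<close> ensures that they lie in the chart image again, where
      \<open>F\<close> agrees with \<open>f\<close> and hence vanishes.\<close>
    obtain T' where T': "open T'" "\<phi> ` W = half_space M \<inter> T'"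
      using chart_image[OF ch(1)] by (auto simp: openin_open)
    have pT: "p \<in> T \<inter> T'" using T(2) T'(2) ch(2) by (auto simp: p_def)
    obtain B q where B: "open B" "p \<in> B" "B \<subseteq> T \<inter> T'" "\<And>k. Ck_open k B q"
      "\<And>y. y \<in> B \<Longrightarrow> y - ((n \<bullet> y) / (n \<bullet> n)) *\<^sub>R n \<in> T \<inter> T'"
      "\<And>y. y \<in> B \<Longrightarrow> F y = F (y - ((n \<bullet> y) / (n \<bullet> n)) *\<^sub>R n) + (n \<bullet> y) * q y"
      using Hadamard_lemma[OF open_Int[OF T(1) T'(1)] pT n(2) Ck_open_subset[OF T(3) Int_lower1]]
      by blast
    have form: "f (inv_into W \<phi> y) = (n \<bullet> y) * q y" if y: "y \<in> \<phi> ` W" "y \<in> B" for y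
    proof -
      define z where "z = y - ((n \<bullet> y) / (n \<bullet> n)) *\<^sub>R n"
      have "y \<in> E" using y(1) T'(2) by (auto simp: half_space_def)
      then have "z \<in> E"
        unfolding z_def using subspace_E n_in_E by (intro subspace_diff subspace_scale)
      moreover have "n \<bullet> z = 0" using n by (simp add: z_def inner_diff_right)
      ultimately have z: "z \<in> half_space_boundary M" "z \<in> half_space M"
        using n by (auto simp: half_space_boundary_def half_space_def)
      have zT: "z \<in> T \<inter> T'" using B(5)[OF y(2)] by (simp add: z_def)
      then have zW: "z \<in> \<phi> ` W" using z T' by blast
      then have "inv_into W \<phi> z \<in> bdry"
        using boundary_iff_chart[OF f ch(1)] z(1) by (simp add: inv_into_into f_inv_into_f)
      then have "f (inv_into W \<phi> z) = 0"
        using bdf_zero_iff[OF f] boundary_subset by blast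
      then have "F z = 0" using T(4) zW zT by simp
      moreover have "F y = f (inv_into W \<phi> y)" using T(4) y B(3) by blast
      ultimately show ?thesis using B(6)[OF y(2)] by (simp add: z_def)
    qed
    have pW: "p \<in> \<phi> ` W" using ch by (simp add: p_def)
    have lim: "((\<lambda>t. p + t *\<^sub>R n) \<longlongrightarrow> p) (at_right 0)"
      by (auto intro!: tendsto_eq_intros)
    \<comment> \<open>Along the inward ray the difference quotient of \<open>f\<close> equals
      \<open>(n \<bullet> n) * q\<close>. Comparing its limit with the known positive
      \<open>d\<close> gives \<open>q p > 0\<close>.\<close>
    have "isCont q p"
      using Ck_open_imp_continuous_on[OF B(4)] B(1,2) continuous_on_eq_continuous_at by blast
    then have "((\<lambda>t. (n \<bullet> n) * q (p + t *\<^sub>R n)) \<longlongrightarrow> (n \<bullet> n) * q p) (at_right 0)"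
      by (intro tendsto_mult tendsto_const isCont_tendsto_compose[OF _ lim])
    moreover have "\<forall>\<^sub>F t in at_right 0.
        f (inv_into W \<phi> (\<phi> x + t *\<^sub>R n)) / t = (n \<bullet> n) * q (p + t *\<^sub>R n)"
      using ray_in_half_space[OF chart_image[OF ch(1)] pW n_in_E inner_ge_zero]
        topological_tendstoD[OF lim B(1,2)] eventually_at_right_less[of "0::real"]
    proof eventually_elim
      case (elim t)
      then show ?case using form[of "p + t *\<^sub>R n"] n by (simp add: p_def inner_right_distrib)
    qed
    ultimately have "((\<lambda>t. f (inv_into W \<phi> (\<phi> x + t *\<^sub>R n)) / t) \<longlongrightarrow> (n \<bullet> n) * q p) (at_right 0)"
      by (simp add: tendsto_cong)
    with d(3) have "d = (n \<bullet> n) * q p"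
      using tendsto_unique trivial_limit_at_right_real by blast
    with d(2) n(1) have "q p > 0" using zero_less_mult_pos inner_gt_zero_iff by metis
    with B form True show ?thesis by (intro exI[of _ B] exI[of _ q]) auto
  qed
  then obtain B q where B: "open B" "p \<in> B" "\<And>k. Ck_open k B q" "q p > 0"
    "\<And>y. y \<in> \<phi> ` W \<Longrightarrow> y \<in> B \<Longrightarrow> f (inv_into W \<phi> y) = (if x \<in> bdry then n \<bullet> y else 1) * q y"
    by blast
  \<comment> \<open>Positivity of \<open>q\<close> is known only at \<open>p\<close>; continuity
    spreads it to a neighbourhood.\<close>
  define B' where "B' = B \<inter> q -` {0<..}"
  have "open B'"
    unfolding B'_def
    by (rule continuous_open_preimage[OF Ck_open_imp_continuous_on[OF B(3)] B(1) open_greaterThan])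
  show ?thesis
  proof
    show "open B'" by fact
    show "\<phi> x \<in> B'" using B by (simp add: B'_def p_def)
    show "Ck_open k B' q" for k using Ck_open_subset[OF B(3)] by (simp add: B'_def)
  qed (use B(5) in \<open>auto simp: B'_def\<close>)
qed

text \<open>Both functions carry the same weight. Stating the result as a product avoids dividing by
  it, so the identity covers boundary points too, where both sides vanish.\<close>

lemma bdf_local_ratio:
  assumes f: "bdf f\<^sub>1" "bdf f\<^sub>2" and ch: "(W, \<phi>) \<in> charts M" "x \<in> W"
  obtains B q where "open B" "\<phi> x \<in> B" "\<And>k. Ck_open k B q" "\<And>y. y \<in> B \<Longrightarrow> q y > 0"
    "\<And>y. y \<in> W \<Longrightarrow> \<phi> y \<in> B \<Longrightarrow> f\<^sub>1 y = q (\<phi> y) * f\<^sub>2 y"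
proof -
  let ?w = "\<lambda>y. if x \<in> bdry then n \<bullet> y else 1"
  obtain B\<^sub>1 q\<^sub>1 where 1: "open B\<^sub>1" "\<phi> x \<in> B\<^sub>1" "\<And>k. Ck_open k B\<^sub>1 q\<^sub>1" "\<And>y. y \<in> B\<^sub>1 \<Longrightarrow> q\<^sub>1 y > 0"
    "\<And>y. y \<in> \<phi> ` W \<Longrightarrow> y \<in> B\<^sub>1 \<Longrightarrow> f\<^sub>1 (inv_into W \<phi> y) = ?w y * q\<^sub>1 y"
    using bdf_local_form[OF f(1) ch] by blast
  obtain B\<^sub>2 q\<^sub>2 where 2: "open B\<^sub>2" "\<phi> x \<in> B\<^sub>2" "\<And>k. Ck_open k B\<^sub>2 q\<^sub>2" "\<And>y. y \<in> B\<^sub>2 \<Longrightarrow> q\<^sub>2 y > 0"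
    "\<And>y. y \<in> \<phi> ` W \<Longrightarrow> y \<in> B\<^sub>2 \<Longrightarrow> f\<^sub>2 (inv_into W \<phi> y) = ?w y * q\<^sub>2 y"
    using bdf_local_form[OF f(2) ch] by blast
  have op: "open (B\<^sub>1 \<inter> B\<^sub>2)" using 1 2 by blast
  show ?thesis
  proof
    show "open (B\<^sub>1 \<inter> B\<^sub>2)" by fact
    show "\<phi> x \<in> B\<^sub>1 \<inter> B\<^sub>2" using 1 2 by blast
    have "q\<^sub>2 y \<noteq> 0" if "y \<in> B\<^sub>1 \<inter> B\<^sub>2" for y using 2(4)[of y] that by simp
    then show "Ck_open k (B\<^sub>1 \<inter> B\<^sub>2) (\<lambda>y. q\<^sub>1 y * inverse (q\<^sub>2 y))" for k
      by (intro Ck_open_mult Ck_open_inverse op Ck_open_subset[OF 1(3)] Ck_open_subset[OF 2(3)]) auto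
    show "q\<^sub>1 y * inverse (q\<^sub>2 y) > 0" if "y \<in> B\<^sub>1 \<inter> B\<^sub>2" for y
      using that 1(4) 2(4) by simp
    fix y assume y: "y \<in> W" "\<phi> y \<in> B\<^sub>1 \<inter> B\<^sub>2"
    moreover have "inv_into W \<phi> (\<phi> y) = y" using y chart_inj[OF ch(1)] by simp
    moreover have "q\<^sub>2 (\<phi> y) > 0" using 2(4) y by blast
    ultimately show "f\<^sub>1 y = q\<^sub>1 (\<phi> y) * inverse (q\<^sub>2 (\<phi> y)) * f\<^sub>2 y"
      using 1(5)[of "\<phi> y"] 2(5)[of "\<phi> y"] by simp
  qed
qed

end

section \<open>The ratio of two boundary defining functions\<close>

locale two_bdfs = bd_mfd M for M :: "('a, 'e::euclidean_space) bd_manifold" +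
  fixes f\<^sub>1 f\<^sub>2 :: "'a \<Rightarrow> real"
  assumes bdf1: "bdf f\<^sub>1" and bdf2: "bdf f\<^sub>2"
begin

text \<open>A relation with an arbitrary local witness \<open>\<gamma>\<close>: extensions that come
  from different charts, or are pulled back along the action, can then be compared without choosing
  one.\<close>

definition ratio_at :: "'a \<Rightarrow> real \<Rightarrow> bool" where
  "ratio_at x r \<longleftrightarrow> (\<exists>O' \<gamma>. openin X O' \<and> x \<in> O' \<and> continuous_map (subtopology X O') euclideanreal \<gamma> \<and>
     (\<forall>y\<in>O' - bdry. \<gamma> y = f\<^sub>1 y / f\<^sub>2 y) \<and> \<gamma> x = r)"

text \<open>The continuous extension of \<open>f\<^sub>1 / f\<^sub>2\<close> to the boundary. Defining it by a topological property
  makes its invariance under the circle action immediate.\<close>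

definition ratio :: "'a \<Rightarrow> real" where
  "ratio x = (THE r. ratio_at x r)"

text \<open>Two witnesses agree off the boundary, which is dense in the intersection of their
  domains, and continuous maps into a Hausdorff space that agree on a dense set agree.\<close>

lemma ratio_at_unique:
  assumes "ratio_at x r" "ratio_at x r'"
  shows "r = r'"
proof -
  obtain O\<^sub>1 \<gamma>\<^sub>1 where 1: "openin X O\<^sub>1" "x \<in> O\<^sub>1" "continuous_map (subtopology X O\<^sub>1) euclideanreal \<gamma>\<^sub>1"
    "\<And>y. y \<in> O\<^sub>1 - bdry \<Longrightarrow> \<gamma>\<^sub>1 y = f\<^sub>1 y / f\<^sub>2 y" "\<gamma>\<^sub>1 x = r"
    using assms(1) unfolding ratio_at_def by blast
  obtain O\<^sub>2 \<gamma>\<^sub>2 where 2: "openin X O\<^sub>2" "x \<in> O\<^sub>2" "continuous_map (subtopology X O\<^sub>2) euclideanreal \<gamma>\<^sub>2"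
    "\<And>y. y \<in> O\<^sub>2 - bdry \<Longrightarrow> \<gamma>\<^sub>2 y = f\<^sub>1 y / f\<^sub>2 y" "\<gamma>\<^sub>2 x = r'"
    using assms(2) unfolding ratio_at_def by blast
  let ?O = "O\<^sub>1 \<inter> O\<^sub>2"
  have op: "openin X ?O" using 1 2 by blast
  have "\<gamma>\<^sub>1 x = \<gamma>\<^sub>2 x"
  proof (rule forall_in_closure_of_eq[where f = \<gamma>\<^sub>1 and g = \<gamma>\<^sub>2 and x = x])
    show "x \<in> subtopology X ?O closure_of (?O - bdry)"
      unfolding in_closure_of
    proof (intro conjI allI impI)
      show "x \<in> topspace (subtopology X ?O)"
        using 1(2) 2(2) openin_subset[OF op] by auto
      fix T assume T: "x \<in> T \<and> openin (subtopology X ?O) T"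
      then have "openin X T" using op openin_trans_full by blast
      then obtain y where "y \<in> T" "y \<notin> bdry"
        using interior_dense[OF bdf1] T by blast
      moreover have "T \<subseteq> ?O" using T openin_imp_subset by blast
      ultimately show "\<exists>y. y \<in> ?O - bdry \<and> y \<in> T" by blast
    qed
    show "continuous_map (subtopology X ?O) euclideanreal \<gamma>\<^sub>1"
      using 1(3) continuous_map_from_subtopology_mono by blast
    show "continuous_map (subtopology X ?O) euclideanreal \<gamma>\<^sub>2"
      using 2(3) continuous_map_from_subtopology_mono by blast
    show "\<gamma>\<^sub>1 y = \<gamma>\<^sub>2 y" if "y \<in> ?O - bdry" for y
      using 1(4) 2(4) that by simp
  qed simp
  with 1 2 show ?thesis by simp
qed

lemma ratio_eqI: "ratio_at x r \<Longrightarrow> ratio x = r"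
  unfolding ratio_def using ratio_at_unique by blast

text \<open>One smooth \<open>q\<close> represents the ratio at all points of the chart near
  \<open>x\<close>, not just at \<open>x\<close>. This makes \<open>ratio\<close> smooth up to the
  boundary.\<close>

lemma ratio_in_chart:
  assumes ch: "(W, \<phi>) \<in> charts M" "x \<in> W"
  obtains B q where "open B" "\<phi> x \<in> B" "\<And>k. Ck_open k B q" "\<And>y. y \<in> B \<Longrightarrow> q y > 0"
    "\<And>y. y \<in> W \<Longrightarrow> \<phi> y \<in> B \<Longrightarrow> ratio_at y (q (\<phi> y))"
    "\<And>y. y \<in> W \<Longrightarrow> \<phi> y \<in> B \<Longrightarrow> f\<^sub>1 y = q (\<phi> y) * f\<^sub>2 y"
proof -
  obtain B q where B: "open B" "\<phi> x \<in> B" "\<And>k. Ck_open k B q" "\<And>y. y \<in> B \<Longrightarrow> q y > 0"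
    "\<And>y. y \<in> W \<Longrightarrow> \<phi> y \<in> B \<Longrightarrow> f\<^sub>1 y = q (\<phi> y) * f\<^sub>2 y"
    using bdf_local_ratio[OF bdf1 bdf2 ch] by blast
  define O' where "O' = {y \<in> W. \<phi> y \<in> B}"
  have op: "openin X O'"
    unfolding O'_def by (rule chart_preimage_open[OF ch(1) B(1)])
  have "continuous_map (subtopology X O') euclidean \<phi>"
    using chart_continuous[OF ch(1)] continuous_map_from_subtopology_mono[of X W euclidean \<phi> O']
    by (auto simp: O'_def)
  then have "continuous_map (subtopology X O') (top_of_set B) \<phi>"
    by (auto simp: continuous_map_in_subtopology O'_def)
  moreover have "continuous_map (top_of_set B) euclideanreal q"
    using Ck_open_imp_continuous_on[OF B(3)] by simp
  ultimately have "continuous_map (subtopology X O') euclideanreal (q \<circ> \<phi>)"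
    by (rule continuous_map_compose)
  moreover have "(q \<circ> \<phi>) y = f\<^sub>1 y / f\<^sub>2 y" if "y \<in> O' - bdry" for y
  proof -
    have "f\<^sub>2 y > 0" using that openin_subset[OF op] by (intro bdf_pos[OF bdf2]) auto
    then show ?thesis using B(5)[of y] that by (simp add: O'_def)
  qed
  ultimately have "ratio_at y (q (\<phi> y))" if "y \<in> W" "\<phi> y \<in> B" for y
    unfolding ratio_at_def using op that by (intro exI[of _ O'] exI[of _ "q \<circ> \<phi>"]) (auto simp: O'_def)
  with B that show ?thesis by blast
qed

lemma
  assumes "x \<in> topspace X"
  shows ratio_at_ratio: "ratio_at x (ratio x)"
    and ratio_pos: "ratio x > 0"
    and ratio_mult: "f\<^sub>1 x = ratio x * f\<^sub>2 x"
proof -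
  obtain W \<phi> where ch: "(W, \<phi>) \<in> charts M" "x \<in> W"
    using chart_exists[OF assms] .
  obtain B q where B: "open B" "\<phi> x \<in> B" "\<And>k. Ck_open k B q" "\<And>y. y \<in> B \<Longrightarrow> q y > 0"
    "\<And>y. y \<in> W \<Longrightarrow> \<phi> y \<in> B \<Longrightarrow> ratio_at y (q (\<phi> y))"
    "\<And>y. y \<in> W \<Longrightarrow> \<phi> y \<in> B \<Longrightarrow> f\<^sub>1 y = q (\<phi> y) * f\<^sub>2 y"
    using ratio_in_chart[OF ch] by blast
  have *: "ratio_at x (q (\<phi> x))" using B(5) ch B(2) by blast
  show "ratio_at x (ratio x)" "ratio x > 0" "f\<^sub>1 x = ratio x * f\<^sub>2 x"
    using * B(4)[OF B(2)] B(6)[OF ch(2) B(2)] by (simp_all add: ratio_eqI[OF *])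
qed

text \<open>A witness at \<open>a x\<close> composed with \<open>a\<close> is a witness at
  \<open>x\<close>, because the quotient is unchanged by \<open>a\<close>. Continuity of
  \<open>a\<close> is enough.\<close>

lemma ratio_invariant:
  assumes V: "openin X V" "x \<in> V" and a: "continuous_map (subtopology X V) X a"
    and inv: "\<And>y. y \<in> V \<Longrightarrow> f\<^sub>1 (a y) = f\<^sub>1 y" "\<And>y. y \<in> V \<Longrightarrow> f\<^sub>2 (a y) = f\<^sub>2 y"
  shows "ratio (a x) = ratio x"
proof -
  have V': "V \<subseteq> topspace X" using openin_subset[OF V(1)] .
  have aV: "a y \<in> topspace X" if "y \<in> V" for y
    using continuous_map_image_subset_topspace[OF a] that V' by auto
  obtain O' \<gamma> where 1: "openin X O'" "a x \<in> O'" "continuous_map (subtopology X O') euclideanreal \<gamma>"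
    "\<And>y. y \<in> O' - bdry \<Longrightarrow> \<gamma> y = f\<^sub>1 y / f\<^sub>2 y" "\<gamma> (a x) = ratio (a x)"
    using ratio_at_ratio[OF aV[OF V(2)]] unfolding ratio_at_def by blast
  define O'' where "O'' = {y \<in> V. a y \<in> O'}"
  have "openin (subtopology X V) {y \<in> topspace (subtopology X V). a y \<in> O'}"
    using a 1(1) by (rule openin_continuous_map_preimage)
  moreover have "topspace (subtopology X V) = V" using V' by auto
  ultimately have op: "openin X O''"
    unfolding O''_def using V(1) openin_trans_full by fastforce
  have "continuous_map (subtopology X O'') X a"
    using a continuous_map_from_subtopology_mono[of X V X a O''] by (auto simp: O''_def)
  then have "continuous_map (subtopology X O'') (subtopology X O') a"
    by (auto simp: continuous_map_in_subtopology O''_def)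
  from continuous_map_compose[OF this 1(3)]
  have "continuous_map (subtopology X O'') euclideanreal (\<gamma> \<circ> a)" .
  moreover have "(\<gamma> \<circ> a) y = f\<^sub>1 y / f\<^sub>2 y" if y: "y \<in> O'' - bdry" for y
  proof -
    have "y \<in> V" "a y \<in> O'" using y by (auto simp: O''_def)
    \<comment> \<open>The boundary is the zero set of \<open>f\<^sub>1\<close>, so invariance of
      \<open>f\<^sub>1\<close> keeps \<open>a\<close> from moving other points into it.\<close>
    moreover have "a y \<notin> bdry"
      using bdf_zero_iff[OF bdf1] inv(1)[OF \<open>y \<in> V\<close>] aV[OF \<open>y \<in> V\<close>] y V' \<open>y \<in> V\<close>
      by (metis DiffD2 subsetD)
    ultimately show ?thesis using 1(4)[of "a y"] inv by simp
  qed
  ultimately have "ratio_at x (ratio (a x))"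
    unfolding ratio_at_def using op V(2) 1(2,5)
    by (intro exI[of _ O''] exI[of _ "\<gamma> \<circ> a"]) (auto simp: O''_def)
  then show ?thesis using ratio_eqI by simp
qed

text \<open>In a chart the new function is a local extension of \<open>H\<close> composed with
  \<open>(y, z) \<mapsto> (y, sqrt (q y) z)\<close>, which is smooth on an open ambient set because
  \<open>q\<close> is positive on all of \<open>B\<close>.\<close>

lemma smooth_rescale:
  assumes "smooth_fun_times_complex M V H" "V' \<subseteq> V"
  shows "smooth_fun_times_complex M V' (\<lambda>(x, z). H (x, complex_of_real (sqrt (ratio x)) * z))"
proof -
  have "smooth_on (\<phi> ` (W \<inter> V') \<times> UNIV)
      (\<lambda>(y, z). H (inv_into W \<phi> y, complex_of_real (sqrt (ratio (inv_into W \<phi> y))) * z))"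
    if ch: "(W, \<phi>) \<in> charts M" for W \<phi>
  proof -
    let ?i = "inv_into W \<phi>"
    have H: "smooth_on (\<phi> ` (W \<inter> V) \<times> UNIV) (\<lambda>(y, z). H (?i y, z))"
      using assms(1) ch unfolding smooth_fun_times_complex_def by blast
    have "\<exists>A g. open A \<and> (\<phi> x, z) \<in> A \<and> (\<forall>k. Ck_open k A g) \<and>
        (\<forall>y\<in>\<phi> ` (W \<inter> V') \<times> UNIV \<inter> A.
          g y = (\<lambda>(y, z). H (?i y, complex_of_real (sqrt (ratio (?i y))) * z)) y)"
      if x: "x \<in> W" "x \<in> V'" for x z
    proof -
      obtain B q where B: "open B" "\<phi> x \<in> B" "\<And>k. Ck_open k B q" "\<And>y. y \<in> B \<Longrightarrow> q y > 0"
        "\<And>y. y \<in> W \<Longrightarrow> \<phi> y \<in> B \<Longrightarrow> ratio_at y (q (\<phi> y))"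
        "\<And>y. y \<in> W \<Longrightarrow> \<phi> y \<in> B \<Longrightarrow> f\<^sub>1 y = q (\<phi> y) * f\<^sub>2 y"
        using ratio_in_chart[OF ch x(1)] by blast
      define \<Phi> :: "'e \<times> complex \<Rightarrow> 'e \<times> complex"
        where "\<Phi> w = (fst w, sqrt (q (fst w)) *\<^sub>R snd w)" for w
      have opB: "open (B \<times> (UNIV :: complex set))" using B(1) by (simp add: open_Times)
      have fstB: "Ck_open k (B \<times> (UNIV :: complex set)) fst"
        and sndB: "Ck_open k (B \<times> (UNIV :: complex set)) snd" for k
        by (intro Ck_open_linear bounded_linear_fst bounded_linear_snd opB)+
      have qB: "Ck_open k (B \<times> (UNIV :: complex set)) (\<lambda>w. q (fst w))" for k
        by (rule Ck_open_compose[OF opB B(1) _ fstB B(3)]) auto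
      have \<Phi>: "Ck_open k (B \<times> UNIV) \<Phi>" for k
        unfolding \<Phi>_def
        by (intro Ck_open_Pair Ck_open_scaleR Ck_open_sqrt fstB sndB qB opB) (use B(4) in auto)
      have "(\<phi> x, sqrt (q (\<phi> x)) *\<^sub>R z) \<in> \<phi> ` (W \<inter> V) \<times> UNIV"
        using x assms(2) by auto
      then obtain T K where T: "open T" "(\<phi> x, sqrt (q (\<phi> x)) *\<^sub>R z) \<in> T" "\<And>k. Ck_open k T K"
        "\<And>w. w \<in> \<phi> ` (W \<inter> V) \<times> UNIV \<Longrightarrow> w \<in> T \<Longrightarrow> K w = (\<lambda>(y, z). H (?i y, z)) w"
        using H unfolding smooth_on_def by (metis (no_types, lifting) Int_iff)
      \<comment> \<open>The rescaled point, not the original one, has to lie in the domain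
        \<open>T\<close> of the extension \<open>K\<close>.\<close>
      define A where "A = (B \<times> UNIV) \<inter> \<Phi> -` T"
      have opA: "open A"
        unfolding A_def
        by (rule continuous_open_preimage[OF Ck_open_imp_continuous_on[OF \<Phi>] opB T(1)])
      have "Ck_open k A (\<lambda>w. K (\<Phi> w))" for k
        by (rule Ck_open_compose[OF opA T(1) _ Ck_open_subset[OF \<Phi>] T(3)]) (auto simp: A_def)
      moreover have "(\<phi> x, z) \<in> A"
        using B(2) T(2) by (simp add: A_def \<Phi>_def)
      moreover have "K (\<Phi> (\<phi> y, u)) = H (?i (\<phi> y), complex_of_real (sqrt (ratio (?i (\<phi> y)))) * u)"
        if y: "y \<in> W" "y \<in> V'" "(\<phi> y, u) \<in> A" for y u
      proof -
        have "\<Phi> (\<phi> y, u) \<in> \<phi> ` (W \<inter> V) \<times> UNIV" "\<Phi> (\<phi> y, u) \<in> T"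
          using y assms(2) by (auto simp: \<Phi>_def A_def)
        moreover have "?i (\<phi> y) = y" using y chart_inj[OF ch] by simp
        moreover have "ratio y = q (\<phi> y)"
          using y B(5) by (intro ratio_eqI) (auto simp: A_def)
        ultimately show ?thesis
          using T(4)[of "\<Phi> (\<phi> y, u)"] by (simp add: \<Phi>_def scaleR_conv_of_real)
      qed
      ultimately show ?thesis using opA
        by (intro exI[of _ A] exI[of _ "\<lambda>w. K (\<Phi> w)"]) auto
    qed
    then show ?thesis
      unfolding smooth_on_def by auto
  qed
  then show ?thesis
    unfolding smooth_fun_times_complex_def by auto
qed

end

section \<open>Invariant neighbourhoods and the comparison of the function sets\<close>

lemma action_continuous:
  assumes "free_circle_action_near_boundary M U act" "a \<in> circle"
  shows "continuous_map (subtopology (space_of M) U) (subtopology (space_of M) U) (act a)"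
proof -
  have "continuous_map (subtopology (space_of M) U)
      (prod_topology (top_of_set circle) (subtopology (space_of M) U)) (\<lambda>x. (a, x))"
    using assms(2) by (simp add: continuous_map_pairwise comp_def)
  moreover have "continuous_map (prod_topology (top_of_set circle) (subtopology (space_of M) U))
      (subtopology (space_of M) U) (\<lambda>(a, x). act a x)"
    using assms(1) by (simp add: free_circle_action_near_boundary_def)
  ultimately show ?thesis
    using continuous_map_compose by (fastforce simp: comp_def)
qed

text \<open>The saturation of \<open>G\<close> under the circle is invariant, and it stays in
  \<open>N\<close> because \<open>N\<close> is invariant. Writing the translates of \<open>G\<close>
  as preimages makes their openness a matter of continuity. This supplies the open set required for
  cut functions when \<open>N\<close> is not open.\<close>

lemma open_invariant_between:
  assumes act: "free_circle_action_near_boundary M U act"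
    and "openin (space_of M) G" "G \<subseteq> N" "N \<subseteq> U" "circle_invariant act N"
  obtains V where "openin (space_of M) V" "G \<subseteq> V" "V \<subseteq> N" "circle_invariant act V"
proof
  let ?V = "\<Union>a\<in>circle. {x \<in> U. act a x \<in> G}"
  have U: "openin (space_of M) U" "topspace (subtopology (space_of M) U) = U"
    using act openin_subset by (auto simp: free_circle_action_near_boundary_def)
  have act_U: "act a x \<in> U" if "a \<in> circle" "x \<in> U" for a x
    using act that by (auto simp: free_circle_action_near_boundary_def)
  have act_1: "act 1 x = x" if "x \<in> U" for x
    using act that by (auto simp: free_circle_action_near_boundary_def)
  have act_mult: "act a (act b x) = act (a * b) x" if "a \<in> circle" "b \<in> circle" "x \<in> U" for a b x
    using act that by (auto simp: free_circle_action_near_boundary_def)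
  have circ: "inverse a \<in> circle" "inverse a * a = 1" "a * inverse a = 1" if "a \<in> circle" for a :: complex
  proof -
    have "a \<noteq> 0" using that by auto
    then show "inverse a \<in> circle" "inverse a * a = 1" "a * inverse a = 1"
      using that by (simp_all add: norm_inverse)
  qed
  have "openin (space_of M) {x \<in> U. act a x \<in> G}" if "a \<in> circle" for a
  proof -
    have "openin (subtopology (space_of M) U) G"
      using assms by (meson openin_open_subtopology U(1) order_trans)
    from openin_continuous_map_preimage[OF action_continuous[OF act that] this]
    show ?thesis using U openin_trans_full by fastforce
  qed
  then show "openin (space_of M) ?V" by blast
  show "G \<subseteq> ?V"
  proof
    fix x assume "x \<in> G"
    then have "x \<in> U" "act 1 x \<in> G" using assms(3,4) act_1[of x] by auto
    then show "x \<in> ?V" by (intro UN_I[of 1]) auto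
  qed
  show "?V \<subseteq> N"
  proof clarify
    fix a x assume a: "a \<in> circle" "x \<in> U" "act a x \<in> G"
    then have "act (inverse a) (act a x) \<in> N"
      using assms(3,5) circ unfolding circle_invariant_def by blast
    then show "x \<in> N" using a circ act_mult act_1 by simp
  qed
  show "circle_invariant act ?V"
    unfolding circle_invariant_def
  proof clarify
    fix b a x assume a: "b \<in> circle" "a \<in> circle" "x \<in> U" "act a x \<in> G"
    \<comment> \<open>The point \<open>act b x\<close> is brought into \<open>G\<close> by undoing
      \<open>b\<close> and then applying \<open>a\<close>.\<close>
    have "act (a * inverse b) (act b x) = act (a * inverse b * b) x"
      using a circ by (intro act_mult) (auto simp: norm_mult norm_inverse)
    also have "\<dots> = act a x" using circ[OF a(1)] by (simp add: mult.assoc)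
    finally show "act b x \<in> ?V"
      using a act_U by (auto intro!: bexI[of _ "a * inverse b"] simp: norm_mult norm_inverse)
  qed
qed

text \<open>The hypotheses are symmetric in the two functions, so one inclusion suffices. Smoothness
  on the interior does not refer to \<open>f\<close> and carries over; only the representative near
  the boundary has to be replaced.\<close>

lemma cut_functions_subset:
  assumes M: "manifold_with_boundary M"
    and act: "free_circle_action_near_boundary M U act"
    and f\<^sub>1: "invariant_boundary_defining M U act f\<^sub>1"
    and f\<^sub>2: "invariant_boundary_defining M U act f\<^sub>2"
  shows "cut_functions M U act f\<^sub>1 \<subseteq> cut_functions M U act f\<^sub>2"
proof
  interpret bd_mfd M by standard (fact M)
  interpret two_bdfs M f\<^sub>1 f\<^sub>2
    by standard (use f\<^sub>1 f\<^sub>2 in \<open>auto simp: bdf_def invariant_boundary_defining_def\<close>)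
  fix h assume h: "h \<in> cut_functions M U act f\<^sub>1"
  then obtain V H where V: "openin X V" "bdry \<subseteq> V" "V \<subseteq> U" "circle_invariant act V"
    and H: "smooth_fun_times_complex M V H"
      "\<And>a x z. a \<in> circle \<Longrightarrow> x \<in> V \<Longrightarrow> H (act a x, z) = H (x, a * z)"
      "\<And>x. x \<in> V \<Longrightarrow> (h \<circ> cut_map M act) x = H (x, complex_of_real (sqrt (f\<^sub>1 x)))"
    unfolding cut_functions_def by blast
  obtain N\<^sub>1 G\<^sub>1 where 1: "openin X G\<^sub>1" "bdry \<subseteq> G\<^sub>1" "G\<^sub>1 \<subseteq> N\<^sub>1" "circle_invariant act N\<^sub>1"
    "\<And>a x. a \<in> circle \<Longrightarrow> x \<in> N\<^sub>1 \<Longrightarrow> f\<^sub>1 (act a x) = f\<^sub>1 x"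
    using f\<^sub>1 unfolding invariant_boundary_defining_def by blast
  obtain N\<^sub>2 G\<^sub>2 where 2: "openin X G\<^sub>2" "bdry \<subseteq> G\<^sub>2" "G\<^sub>2 \<subseteq> N\<^sub>2" "circle_invariant act N\<^sub>2"
    "\<And>a x. a \<in> circle \<Longrightarrow> x \<in> N\<^sub>2 \<Longrightarrow> f\<^sub>2 (act a x) = f\<^sub>2 x"
    using f\<^sub>2 unfolding invariant_boundary_defining_def by blast
  \<comment> \<open>The smaller set is open, the larger one invariant; a set between them with both
    properties carries the domain of \<open>H\<close> and the invariance of both functions.\<close>
  have "openin X (V \<inter> G\<^sub>1 \<inter> G\<^sub>2)" using V 1 2 by blast
  moreover have "circle_invariant act (V \<inter> N\<^sub>1 \<inter> N\<^sub>2)"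
    using V 1 2 unfolding circle_invariant_def by blast
  ultimately obtain V' where V': "openin X V'" "V \<inter> G\<^sub>1 \<inter> G\<^sub>2 \<subseteq> V'" "V' \<subseteq> V \<inter> N\<^sub>1 \<inter> N\<^sub>2"
    "circle_invariant act V'"
    using open_invariant_between[OF act, of "V \<inter> G\<^sub>1 \<inter> G\<^sub>2" "V \<inter> N\<^sub>1 \<inter> N\<^sub>2"] V(3) 1(3) 2(3) by blast
  define H' where "H' = (\<lambda>(x, z). H (x, complex_of_real (sqrt (ratio x)) * z))"
  have "smooth_fun_times_complex M V' H'"
    unfolding H'_def using V' by (intro smooth_rescale[OF H(1)]) blast
  moreover have "H' (act a x, z) = H' (x, a * z)" if "a \<in> circle" "x \<in> V'" for a x z
  proof -
    have "continuous_map (subtopology X U) X (act a)"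
      using action_continuous[OF act that(1)] continuous_map_in_subtopology by blast
    then have "continuous_map (subtopology X V') X (act a)"
      by (rule continuous_map_from_subtopology_mono) (use V' V(3) in blast)
    then have "ratio (act a x) = ratio x"
      using V' 1(5) 2(5) that by (intro ratio_invariant[of V']) auto
    then show ?thesis
      using H(2)[of a x] that V'(3) by (auto simp: H'_def mult_ac)
  qed
  moreover have "(h \<circ> cut_map M act) x = H' (x, complex_of_real (sqrt (f\<^sub>2 x)))" if "x \<in> V'" for x
  proof -
    have "x \<in> topspace X" using openin_subset[OF V'(1)] that by blast
    \<comment> \<open>This includes boundary points, where both roots are zero, since
      \<open>ratio_mult\<close> holds on the whole space.\<close>
    then have "sqrt (f\<^sub>1 x) = sqrt (ratio x) * sqrt (f\<^sub>2 x)"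
      using ratio_mult by (simp add: real_sqrt_mult)
    then show ?thesis using H(3)[of x] that V'(3) by (auto simp: H'_def)
  qed
  moreover have "bdry \<subseteq> V'" "V' \<subseteq> U" using V V' 1 2 by blast+
  ultimately show "h \<in> cut_functions M U act f\<^sub>2"
    using h V'(1,4) unfolding cut_functions_def by blast
qed

theorem lemma1p4:
  fixes M :: "('a, 'e::euclidean_space) bd_manifold"
    and U :: "'a set"
    and act :: "complex \<Rightarrow> 'a \<Rightarrow> 'a"
    and f\<^sub>1 f\<^sub>2 :: "'a \<Rightarrow> real"
  assumes "manifold_with_boundary M"
    and "free_circle_action_near_boundary M U act"
    and "invariant_boundary_defining M U act f\<^sub>1"
    and "invariant_boundary_defining M U act f\<^sub>2"
  shows "cut_functions M U act f\<^sub>1 = cut_functions M U act f\<^sub>2"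
  using assms by (intro equalityI cut_functions_subset)

end
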